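(* For any measure $\mu$ and every $p$ with $0<p<2$, the space $L_p(\mu)$ (in particular $\ell_p$) admits a coarse embedding into a Hilbert space.
   Context: A (not necessarily continuous) map $f\colon X\to Y$ is a coarse embedding if there exist non-decreasing functions $\rho_1,\rho_2\colon[0,\infty)\to[0,\infty)$ such that $\rho_1(d_X(x,y))\le d_Y(f(x),f(y))\le\rho_2(d_X(x,y))$ for all $x,y\in X$ and $\lim_{t\to\infty}\rho_1(t)=+\infty$. All Hilbert spaces are real and not necessarily separable. $L_p(\mu)$ is the space of (classes of) real-valued measurable functions with $\int|x|^p\,d\mu<\infty$, with distance $d(x,y)=\Vert x-y\Vert_p=\left(\int|x-y|^p\,d\mu\right)^{1/p}$. For $0<p<1$ this is not a metric, but the definition of coarse embedding is applied verbatim with this $d$ (equivalently, one may use the metric $\Vert x-y\Vert_p^p$, which gives the same notion of coarse embedding). *)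

theory Defs
  imports "HOL-Analysis.Analysis" "HOL-Algebra.Module"
begin

section \<open>Coarse embeddings\<close>

text \<open>The distance functions are arbitrary: for \<open>p < 1\<close> the natural distance on \<open>L\<^sub>p\<close> violates the
  triangle inequality.\<close>

definition coarse_embedding ::
  "'x set \<Rightarrow> ('x \<Rightarrow> 'x \<Rightarrow> real) \<Rightarrow> 'y set \<Rightarrow> ('y \<Rightarrow> 'y \<Rightarrow> real) \<Rightarrow> ('x \<Rightarrow> 'y) \<Rightarrow> bool" where
  "coarse_embedding X dX Y dY f \<longleftrightarrow>
     f \<in> X \<rightarrow> Y \<and>
     (\<exists>\<rho>1 \<rho>2 :: real \<Rightarrow> real.
        \<rho>1 \<in> {0..} \<rightarrow> {0..} \<and> mono_on {0..} \<rho>1 \<and>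
        \<rho>2 \<in> {0..} \<rightarrow> {0..} \<and> mono_on {0..} \<rho>2 \<and>
        (\<forall>x\<in>X. \<forall>y\<in>X. \<rho>1 (dX x y) \<le> dY (f x) (f y) \<and> dY (f x) (f y) \<le> \<rho>2 (dX x y)) \<and>
        filterlim \<rho>1 at_top at_top)"


section \<open>Real Hilbert spaces\<close>

text \<open>The theorem asserts that some Hilbert space exists, which cannot be expressed by a type of
  class \<open>{real_inner, complete_space}\<close>. Hilbert spaces are therefore structures with an explicit
  carrier. The fields \<open>mult\<close> and \<open>one\<close> inherited from the module record play no role.\<close>

definition real_ring :: "real ring" where
  "real_ring = \<lparr>carrier = UNIV, monoid.mult = (*), one = 1, zero = 0, add = (+)\<rparr>"

record 'h inner_product_structure = "(real, 'h) module" +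
  ip :: "'h \<Rightarrow> 'h \<Rightarrow> real"

definition ip_dist :: "('h, 'z) inner_product_structure_scheme \<Rightarrow> 'h \<Rightarrow> 'h \<Rightarrow> real" where
  "ip_dist H x y = sqrt (ip H (x \<ominus>\<^bsub>H\<^esub> y) (x \<ominus>\<^bsub>H\<^esub> y))"

locale real_Hilbert_space = module real_ring H for H (structure) +
  assumes ip_commute: "\<lbrakk>x \<in> carrier H; y \<in> carrier H\<rbrakk> \<Longrightarrow> ip H x y = ip H y x"
    and ip_add: "\<lbrakk>x \<in> carrier H; y \<in> carrier H; z \<in> carrier H\<rbrakk> \<Longrightarrow>
      ip H (x \<oplus>\<^bsub>H\<^esub> y) z = ip H x z + ip H y z"
    and ip_smult: "\<lbrakk>x \<in> carrier H; y \<in> carrier H\<rbrakk> \<Longrightarrow> ip H (a \<odot>\<^bsub>H\<^esub> x) y = a * ip H x y"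
    and ip_nonneg: "x \<in> carrier H \<Longrightarrow> 0 \<le> ip H x x"
    and ip_definite: "\<lbrakk>x \<in> carrier H; ip H x x = 0\<rbrakk> \<Longrightarrow> x = \<zero>\<^bsub>H\<^esub>"
    and complete: "\<lbrakk>\<And>n. \<sigma> n \<in> carrier H;
        \<And>e. e > 0 \<Longrightarrow> \<exists>N. \<forall>m\<ge>N. \<forall>n\<ge>N. ip_dist H (\<sigma> m) (\<sigma> n) < e\<rbrakk> \<Longrightarrow>
      \<exists>l\<in>carrier H. (\<lambda>n. ip_dist H (\<sigma> n) l) \<longlonglongrightarrow> 0"

text \<open>HOL cannot quantify over the type of the points of the Hilbert space. Taking them of type
  \<open>'x \<Rightarrow> real\<close>, with \<open>'x\<close> the type of the points of the space to be embedded, is no restriction: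
  the lemmas \<open>coarsely_embeds_into_HilbertI\<close> and \<open>coarsely_embeds_into_Hilbert_typeI\<close> below show
  that a coarse embedding into a real Hilbert space over any type suffices.\<close>

definition coarsely_embeds_into_Hilbert :: "'x set \<Rightarrow> ('x \<Rightarrow> 'x \<Rightarrow> real) \<Rightarrow> bool" where
  "coarsely_embeds_into_Hilbert X d \<longleftrightarrow>
     (\<exists>(H :: ('x \<Rightarrow> real) inner_product_structure) f.
        real_Hilbert_space H \<and> coarse_embedding X d (carrier H) (ip_dist H) f)"


section \<open>The spaces \<open>L\<^sub>p(\<mu>)\<close>\<close>

definition Lp_functions :: "real \<Rightarrow> 'a measure \<Rightarrow> ('a \<Rightarrow> real) set" where
  "Lp_functions p M = {x \<in> borel_measurable M. integrable M (\<lambda>t. \<bar>x t\<bar> powr p)}"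

definition ae_equal :: "real \<Rightarrow> 'a measure \<Rightarrow> (('a \<Rightarrow> real) \<times> ('a \<Rightarrow> real)) set" where
  "ae_equal p M =
     {(x, y). x \<in> Lp_functions p M \<and> y \<in> Lp_functions p M \<and> (AE t in M. x t = y t)}"

definition Lp_space :: "real \<Rightarrow> 'a measure \<Rightarrow> ('a \<Rightarrow> real) set set" where
  "Lp_space p M = Lp_functions p M // ae_equal p M"

text \<open>The choice of representatives is immaterial, see \<open>Lp_dist_class\<close> below.\<close>

definition Lp_dist :: "real \<Rightarrow> 'a measure \<Rightarrow> ('a \<Rightarrow> real) set \<Rightarrow> ('a \<Rightarrow> real) set \<Rightarrow> real" where
  "Lp_dist p M A B =
     (\<integral>t. \<bar>(SOME x. x \<in> A) t - (SOME y. y \<in> B) t\<bar> powr p \<partial>M) powr (1 / p)"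

lemma equiv_ae_equal: "equiv (Lp_functions p M) (ae_equal p M)"
proof (rule equivI)
  show "ae_equal p M \<subseteq> Lp_functions p M \<times> Lp_functions p M"
    by (auto simp: ae_equal_def)
  show "refl_on (Lp_functions p M) (ae_equal p M)"
    by (auto simp: refl_on_def ae_equal_def)
  show "sym (ae_equal p M)"
    by (auto simp: sym_def ae_equal_def elim: eventually_mono)
  show "trans (ae_equal p M)"
    by (auto simp: trans_def ae_equal_def elim: eventually_elim2)
qed

lemma Lp_dist_class:
  assumes "A \<in> Lp_space p M" "B \<in> Lp_space p M" "x \<in> A" "y \<in> B"
  shows "Lp_dist p M A B = (\<integral>t. \<bar>x t - y t\<bar> powr p \<partial>M) powr (1 / p)"
proof -
  define x' y' where "x' = (SOME x. x \<in> A)" and "y' = (SOME y. y \<in> B)"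
  have "x' \<in> A"
    unfolding x'_def by (rule someI[of "\<lambda>x. x \<in> A", OF assms(3)])
  moreover have "y' \<in> B"
    unfolding y'_def by (rule someI[of "\<lambda>y. y \<in> B", OF assms(4)])
  ultimately have "(x', x) \<in> ae_equal p M" "(y', y) \<in> ae_equal p M"
    using assms quotient_eq_iff[OF equiv_ae_equal, of A p M A x' x]
      quotient_eq_iff[OF equiv_ae_equal, of B p M B y' y]
    by (simp_all add: Lp_space_def)
  then have ae: "AE t in M. x' t = x t" "AE t in M. y' t = y t"
    and meas: "x \<in> borel_measurable M" "y \<in> borel_measurable M"
      "x' \<in> borel_measurable M" "y' \<in> borel_measurable M"
    by (auto simp: ae_equal_def Lp_functions_def)
  have "(\<integral>t. \<bar>x' t - y' t\<bar> powr p \<partial>M) = (\<integral>t. \<bar>x t - y t\<bar> powr p \<partial>M)"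
    by (rule integral_cong_AE) (use ae meas in \<open>auto elim: eventually_elim2\<close>)
  then show ?thesis
    by (simp add: Lp_dist_def x'_def y'_def)
qed


section \<open>Independence of the type of the Hilbert space\<close>

lemma real_ring_simps [simp]:
  "carrier real_ring = UNIV" "x \<otimes>\<^bsub>real_ring\<^esub> y = x * y" "\<one>\<^bsub>real_ring\<^esub> = 1"
  "\<zero>\<^bsub>real_ring\<^esub> = 0" "x \<oplus>\<^bsub>real_ring\<^esub> y = x + y"
  by (simp_all add: real_ring_def)

lemma cring_real_ring: "cring real_ring"
proof (rule cringI)
  show "abelian_group real_ring"
    by (rule abelian_groupI) (auto intro: exI[of _ "- x" for x] simp: algebra_simps)
  show "comm_monoid real_ring"
    by (rule comm_monoidI) auto
qed (auto simp: algebra_simps)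

context real_Hilbert_space
begin

lemma minus_eq_smult: "x \<in> carrier H \<Longrightarrow> \<ominus>\<^bsub>H\<^esub> x = (-1) \<odot>\<^bsub>H\<^esub> x"
proof -
  assume x: "x \<in> carrier H"
  have "(-1) \<odot>\<^bsub>H\<^esub> x \<oplus>\<^bsub>H\<^esub> x = ((-1) + 1) \<odot>\<^bsub>H\<^esub> x"
    using smult_l_distr[of "-1" 1 x] smult_one[of x] x by simp
  also have "\<dots> = \<zero>\<^bsub>H\<^esub>" using smult_l_null[of x] x by simp
  finally show ?thesis
    using x smult_closed[of "-1" x] by (intro M.minus_equality) auto
qed

lemma ip_dist_eq:
  "\<lbrakk>x \<in> carrier H; y \<in> carrier H\<rbrakk> \<Longrightarrow>
    ip_dist H x y = sqrt (ip H (x \<oplus>\<^bsub>H\<^esub> (-1) \<odot>\<^bsub>H\<^esub> y) (x \<oplus>\<^bsub>H\<^esub> (-1) \<odot>\<^bsub>H\<^esub> y))"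
  by (simp add: ip_dist_def a_minus_def minus_eq_smult)

end

lemma real_Hilbert_spaceI:
  fixes H (structure)
  assumes add: "\<And>x y. \<lbrakk>x \<in> carrier H; y \<in> carrier H\<rbrakk> \<Longrightarrow> x \<oplus> y \<in> carrier H"
    and zero: "\<zero> \<in> carrier H"
    and smult: "\<And>a x. x \<in> carrier H \<Longrightarrow> a \<odot> x \<in> carrier H"
    and assoc: "\<And>x y z. \<lbrakk>x \<in> carrier H; y \<in> carrier H; z \<in> carrier H\<rbrakk> \<Longrightarrow>
      (x \<oplus> y) \<oplus> z = x \<oplus> (y \<oplus> z)"
    and comm: "\<And>x y. \<lbrakk>x \<in> carrier H; y \<in> carrier H\<rbrakk> \<Longrightarrow> x \<oplus> y = y \<oplus> x"
    and lzero: "\<And>x. x \<in> carrier H \<Longrightarrow> \<zero> \<oplus> x = x"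
    and lneg: "\<And>x. x \<in> carrier H \<Longrightarrow> (-1) \<odot> x \<oplus> x = \<zero>"
    and sl: "\<And>a b x. x \<in> carrier H \<Longrightarrow> (a + b) \<odot> x = a \<odot> x \<oplus> b \<odot> x"
    and sr: "\<And>a x y. \<lbrakk>x \<in> carrier H; y \<in> carrier H\<rbrakk> \<Longrightarrow> a \<odot> (x \<oplus> y) = a \<odot> x \<oplus> a \<odot> y"
    and sm: "\<And>a b x. x \<in> carrier H \<Longrightarrow> (a * b) \<odot> x = a \<odot> (b \<odot> x)"
    and s1: "\<And>x. x \<in> carrier H \<Longrightarrow> 1 \<odot> x = x"
    and ip1: "\<And>x y. \<lbrakk>x \<in> carrier H; y \<in> carrier H\<rbrakk> \<Longrightarrow> ip H x y = ip H y x"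
    and ip2: "\<And>x y z. \<lbrakk>x \<in> carrier H; y \<in> carrier H; z \<in> carrier H\<rbrakk> \<Longrightarrow>
      ip H (x \<oplus> y) z = ip H x z + ip H y z"
    and ip3: "\<And>a x y. \<lbrakk>x \<in> carrier H; y \<in> carrier H\<rbrakk> \<Longrightarrow> ip H (a \<odot> x) y = a * ip H x y"
    and ip4: "\<And>x. x \<in> carrier H \<Longrightarrow> 0 \<le> ip H x x"
    and ip5: "\<And>x. \<lbrakk>x \<in> carrier H; ip H x x = 0\<rbrakk> \<Longrightarrow> x = \<zero>"
    and compl: "\<And>\<sigma> :: nat \<Rightarrow> _. \<lbrakk>\<And>n. \<sigma> n \<in> carrier H;
        \<And>e. e > 0 \<Longrightarrow> \<exists>N. \<forall>m\<ge>N. \<forall>n\<ge>N.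
          sqrt (ip H (\<sigma> m \<oplus> (-1) \<odot> \<sigma> n) (\<sigma> m \<oplus> (-1) \<odot> \<sigma> n)) < e\<rbrakk> \<Longrightarrow>
      \<exists>l\<in>carrier H. (\<lambda>n. sqrt (ip H (\<sigma> n \<oplus> (-1) \<odot> l) (\<sigma> n \<oplus> (-1) \<odot> l))) \<longlonglongrightarrow> 0"
  shows "real_Hilbert_space H"
proof -
  have ab: "abelian_group H"
  proof (rule abelian_groupI, goal_cases)
    case (6 x)
    then show ?case using lneg smult by blast
  qed (use add zero assoc comm lzero in auto)
  have mo: "module real_ring H"
    by (rule Module.moduleI) (use cring_real_ring ab smult sl sr sm s1 in auto)
  interpret m: module real_ring H by (rule mo)
  have neg: "\<ominus> x = (-1) \<odot> x" if "x \<in> carrier H" for x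
    using that lneg smult by (intro m.M.minus_equality) auto
  have d: "ip_dist H x y = sqrt (ip H (x \<oplus> (-1) \<odot> y) (x \<oplus> (-1) \<odot> y))"
    if "x \<in> carrier H" "y \<in> carrier H" for x y
    using that by (simp add: ip_dist_def a_minus_def neg)
  show ?thesis
  proof (unfold_locales, goal_cases)
    case (6 \<sigma>)
    obtain l where l: "l \<in> carrier H"
      "(\<lambda>n. sqrt (ip H (\<sigma> n \<oplus> (-1) \<odot> l) (\<sigma> n \<oplus> (-1) \<odot> l))) \<longlonglongrightarrow> 0"
      using compl[of \<sigma>] 6 by (auto simp: d)
    then show ?case using 6(1) by (auto simp: d)
  qed (use ip1 ip2 ip3 ip4 ip5 in auto)
qed

lemma coarsely_embeds_into_HilbertI:
  fixes H :: "('h, 'z) inner_product_structure_scheme" (structure)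
  assumes H: "real_Hilbert_space H"
    and f: "coarse_embedding X d (carrier H) (ip_dist H) f"
  shows "coarsely_embeds_into_Hilbert X d"
proof -
  interpret real_Hilbert_space H by (rule H)
  have fX: "f x \<in> carrier H" if "x \<in> X" for x
    using f that by (auto simp: coarse_embedding_def)
  have sc: "a \<odot> x \<in> carrier H" if "x \<in> carrier H" for a x
    using smult_closed[of a x] that by simp
  have ip0: "ip H \<zero> y = 0" if "y \<in> carrier H" for y
    using ip_add[of \<zero> \<zero> y] that by simp
  have ip_r: "ip H z (x \<oplus> y) = ip H z x + ip H z y" "ip H z (a \<odot> x) = a * ip H z x"
    if "x \<in> carrier H" "y \<in> carrier H" "z \<in> carrier H" for x y z a
    using that ip_add ip_smult sc ip_commute[of z] by auto

  text \<open>The double orthogonal complement of the image is a closed subspace containing the image.\<close>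
  define K where "K = {h \<in> carrier H. \<forall>g\<in>carrier H. (\<forall>x\<in>X. ip H g (f x) = 0) \<longrightarrow> ip H g h = 0}"
  have Kc: "h \<in> carrier H" if "h \<in> K" for h using that by (simp add: K_def)
  have Kf: "f x \<in> K" if "x \<in> X" for x using that fX by (auto simp: K_def)
  have K0: "\<zero> \<in> K" using ip0 ip_commute by (auto simp: K_def)
  have Kadd: "x \<oplus> y \<in> K" if "x \<in> K" "y \<in> K" for x y
    using that by (auto simp: K_def ip_r)
  have Ksm: "a \<odot> x \<in> K" if "x \<in> K" for x a
    using that by (auto simp: K_def ip_r sc)

  define T where "T h = (\<lambda>x. if x \<in> X then ip H h (f x) else 0)" for h
  have inj: "inj_on T K"
  proof (rule inj_onI)
    fix h k assume hk: "h \<in> K" "k \<in> K" "T h = T k"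
    let ?u = "h \<oplus> (-1) \<odot> k"
    have u: "?u \<in> K" using hk Kadd Ksm by blast
    have "ip H ?u (f x) = 0" if "x \<in> X" for x
      using fun_cong[OF hk(3), of x] that hk(1,2) Kc fX sc by (simp add: T_def ip_add ip_smult)
    then have "ip H ?u ?u = 0" using u by (auto simp: K_def)
    then have "?u = \<zero>" using u Kc ip_definite by blast
    then have "h = \<ominus> ((-1) \<odot> k)"
      using hk Kc sc by (metis M.minus_equality)
    also have "\<dots> = k"
      using hk Kc sc minus_eq_smult[of k] by (metis M.minus_minus)
    finally show "h = k" .
  qed
  define S where "S = inv_into K T"
  have ST: "S (T h) = h" if "h \<in> K" for h
    using inj that by (simp add: S_def)
  define H' :: "('a \<Rightarrow> real) inner_product_structure" where
    "H' = \<lparr>carrier = T ` K, monoid.mult = undefined, one = undefined, zero = T \<zero>,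
       add = (\<lambda>u v. T (S u \<oplus> S v)), smult = (\<lambda>a u. T (a \<odot> S u)), ip = (\<lambda>u v. ip H (S u) (S v))\<rparr>"
  have H'_simps: "carrier H' = T ` K" "zero H' = T \<zero>" "add H' u v = T (S u \<oplus> S v)"
    "smult H' a u = T (a \<odot> S u)" "ip H' u v = ip H (S u) (S v)" for u v a
    by (simp_all add: H'_def)
  note simps = H'_simps ST K0 Kadd Ksm Kc
  have neg: "(-1) \<odot> x \<oplus> x = \<zero>" if "x \<in> carrier H" for x
    using that M.l_neg[of x] minus_eq_smult[of x] by simp
  have H': "real_Hilbert_space H'"
  proof (rule real_Hilbert_spaceI, goal_cases)
    case (17 \<sigma>)
    define \<tau> where "\<tau> n = S (\<sigma> n)" for n
    have \<tau>: "\<tau> n \<in> K" "\<sigma> n = T (\<tau> n)" for n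
      using 17(1)[of n] by (auto simp: \<tau>_def simps)
    have "\<exists>N. \<forall>m\<ge>N. \<forall>n\<ge>N. ip_dist H (\<tau> m) (\<tau> n) < e" if "e > 0" for e
      using 17(2)[OF that] \<tau> by (simp add: simps ip_dist_eq)
    then obtain l where l: "l \<in> carrier H" "(\<lambda>n. ip_dist H (\<tau> n) l) \<longlonglongrightarrow> 0"
      using complete[of \<tau>] \<tau> Kc by blast
    have "l \<in> K"
      unfolding K_def
    proof (intro CollectI conjI l(1) ballI impI)
      fix g assume g: "g \<in> carrier H" "\<forall>x\<in>X. ip H g (f x) = 0"
      let ?w = "\<lambda>n. \<tau> n \<oplus> (-1) \<odot> l"
      have w: "?w n \<in> carrier H" for n using \<tau> Kc l sc by auto
      have gw: "ip H g (?w n) = - ip H g l" for n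
        using \<tau>[of n] g l sc by (simp add: ip_r K_def)
      have CS: "(ip H g l)\<^sup>2 \<le> ip H g g * (ip_dist H (\<tau> n) l)\<^sup>2" for n
      proof -
        let ?a = "ip H g g" and ?b = "ip H g (?w n)" and ?c = "ip H (?w n) (?w n)"
        have q: "0 \<le> s\<^sup>2 * ?a + 2 * s * t * ?b + t\<^sup>2 * ?c" for s t
        proof -
          have "0 \<le> ip H (s \<odot> g \<oplus> t \<odot> ?w n) (s \<odot> g \<oplus> t \<odot> ?w n)"
            using g w sc by (intro ip_nonneg) auto
          also have "\<dots> = s\<^sup>2 * ?a + 2 * s * t * ?b + t\<^sup>2 * ?c"
            using g(1) w[of n] sc[OF g(1)] sc[OF w[of n]] ip_commute[of "?w n" g]
            by (simp del: M.add.m_assoc add: ip_add ip_smult ip_r power2_eq_square algebra_simps)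
          finally show ?thesis .
        qed
        have "?b\<^sup>2 \<le> ?a * ?c"
        proof (cases "?a = 0")
          case True
          then have "g = \<zero>" using g ip_definite by blast
          then show ?thesis using ip0 w True by simp
        next
          case False
          then have "?a > 0" using ip_nonneg[OF g(1)] by simp
          moreover have "0 \<le> ?a * (?a * ?c - ?b\<^sup>2)"
            using q[of "- ?b" ?a] by (simp add: power2_eq_square algebra_simps)
          ultimately show ?thesis by (simp add: zero_le_mult_iff)
        qed
        then show ?thesis
          using gw \<tau>[of n] Kc l(1) ip_nonneg[OF w[of n]] by (simp add: ip_dist_eq)
      qed
      have "(\<lambda>n. ip H g g * (ip_dist H (\<tau> n) l)\<^sup>2) \<longlonglongrightarrow> ip H g g * 0\<^sup>2"
        by (intro tendsto_intros l)
      then have "(ip H g l)\<^sup>2 \<le> ip H g g * 0\<^sup>2"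
        by (rule LIMSEQ_le_const) (use CS in auto)
      then show "ip H g l = 0" by simp
    qed
    show ?case
    proof
      show "T l \<in> carrier H'" using \<open>l \<in> K\<close> by (simp add: simps)
      show "(\<lambda>n. sqrt (ip H' (\<sigma> n \<oplus>\<^bsub>H'\<^esub> (-1) \<odot>\<^bsub>H'\<^esub> T l) (\<sigma> n \<oplus>\<^bsub>H'\<^esub> (-1) \<odot>\<^bsub>H'\<^esub> T l))) \<longlonglongrightarrow> 0"
        using l(2) \<open>l \<in> K\<close> \<tau> by (simp add: simps ip_dist_eq)
    qed
  next
    case (16 x) then show ?case using ip_definite Kc by (metis H'_simps(1,2,5) ST imageE)
  next
    case (8 a b x) then show ?case
      using smult_l_distr[of a b] Kc by (auto simp: simps)
  next
    case (9 a x y) then show ?case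
      using smult_r_distr[of a] Kc by (auto simp: simps)
  next
    case (10 a b x) then show ?case
      using smult_assoc1[of a b] Kc by (auto simp: simps)
  next
    case (11 x) then show ?case
      using smult_one Kc by (auto simp: simps)
  next
    case (4 x y z) then show ?case using M.a_assoc by (auto simp: simps)
  next
    case (5 x y) then show ?case using M.a_comm by (auto simp: simps)
  next
    case (7 x) then show ?case using neg by (auto simp: simps)
  next
    case (12 x y) then show ?case using ip_commute Kc by (auto simp: simps)
  qed (auto simp: simps ip_add ip_smult ip_nonneg sc)
  interpret H': real_Hilbert_space H' by (rule H')
  have dist: "ip_dist H' (T h) (T k) = ip_dist H h k" if "h \<in> K" "k \<in> K" for h k
    using that H'.ip_dist_eq[of "T h" "T k"] by (simp add: simps ip_dist_eq)
  have "coarse_embedding X d (carrier H') (ip_dist H') (T \<circ> f)"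
    using f Kf by (auto simp: coarse_embedding_def dist H'_simps)
  then show ?thesis
    using H' unfolding coarsely_embeds_into_Hilbert_def by blast
qed

lemma coarsely_embeds_into_Hilbert_typeI:
  fixes f :: "'x \<Rightarrow> 'h :: {real_inner, complete_space}"
  assumes "coarse_embedding X d UNIV dist f"
  shows "coarsely_embeds_into_Hilbert X d"
proof -
  define H :: "'h inner_product_structure" where
    "H = \<lparr>carrier = UNIV, monoid.mult = undefined, one = undefined, zero = 0,
       add = (+), smult = scaleR, ip = inner\<rparr>"
  have simps: "carrier H = UNIV" "zero H = 0" "add H u v = u + v"
    "smult H a u = a *\<^sub>R u" "ip H u v = inner u v" for u v a
    by (simp_all add: H_def)
  have H: "real_Hilbert_space H"
  proof (rule real_Hilbert_spaceI, goal_cases)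
    case (17 \<sigma>)
    then have "Cauchy \<sigma>"
      by (simp add: simps Cauchy_def dist_norm norm_eq_sqrt_inner)
    then obtain l where "\<sigma> \<longlonglongrightarrow> l"
      using Cauchy_convergent_iff convergent_def by blast
    then have "(\<lambda>n. norm (\<sigma> n - l)) \<longlonglongrightarrow> 0"
      using LIM_zero tendsto_norm_zero by blast
    then show ?case by (auto simp: simps norm_eq_sqrt_inner)
  qed (auto simp: simps inner_commute algebra_simps inner_add_left)
  interpret H: real_Hilbert_space H by (rule H)
  have "ip_dist H = dist"
    by (intro ext) (simp add: H.ip_dist_eq simps dist_norm norm_eq_sqrt_inner)
  then show ?thesis
    using coarsely_embeds_into_HilbertI[OF H, of X d f] assms by (simp add: simps)
qed

end

theory Submission
  imports Defs "HOL-Real_Asymp.Real_Asymp"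
begin

text \<open>The theorem rests on Schoenberg's observation that, for \<open>0 < p < 2\<close>, the function
  \<open>\<bar>a - b\<bar> powr p\<close> is a squared Hilbert space distance on the real line. The reason is the identity
  \<open>(\<integral>s. (2 - 2 * cos (s * (a - b))) * \<bar>s\<bar> powr (- (1 + p)))  =  c * \<bar>a - b\<bar> powr p\<close>,
  where the left-hand side is finite for these \<open>p\<close> and has the right dependence on \<open>a - b\<close> by the
  substitution \<open>s \<mapsto> (a - b) * s\<close>. The factor \<open>2 - 2 * cos (s * (a - b))\<close> is the square of the distance
  between two points of the unit circle, with angles \<open>s * a\<close> and \<open>s * b\<close>, so \<open>a\<close> may be sent to the
  function of \<open>s\<close> that runs through these points, weighted by the square root of the power of \<open>\<bar>s\<bar>\<close>.
  The real function \<open>wave p a\<close> below replaces the point of the circle by the sum of its coordinates (up to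
  a constant that differences do not see); the cross terms that arise cancel between \<open>s\<close> and \<open>- s\<close> (\<open>nn_integral_wave_diff\<close>).

  Applying this map to the values of a function \<open>x\<close> on the measure space gives a function of the pair
  \<open>(t, s)\<close>. By Tonelli's theorem the squared distance in \<open>L\<^sub>2\<close> of the product of \<open>\<mu>\<close> with Lebesgue
  measure, between the images of \<open>x\<close> and \<open>y\<close>, is \<open>c * (\<integral>t. \<bar>x t - y t\<bar> powr p)\<close>
  (\<open>integral_wave_pair\<close>), that is, \<open>c\<close> times the \<open>p\<close>-th power of the distance in \<open>L\<^sub>p\<close>.
  Both control functions of the embedding are therefore \<open>\<lambda>d. sqrt c * d powr (p / 2)\<close>. Only the second factor has to be
  \<open>\<sigma>\<close>-finite for the iterated integral, with the integral over \<open>s\<close> innermost, to represent the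
  integral over the product, so \<open>\<mu>\<close> may be arbitrary.

  The Hilbert space itself is the space \<open>L\<^sub>2\<close> of this product measure; its completeness is the
  classical theorem of Riesz and Fischer (\<open>square_integrable_complete\<close>).\<close>

section \<open>The Hilbert space of square-integrable functions\<close>

definition square_integrable :: "'a measure \<Rightarrow> ('a \<Rightarrow> real) set" where
  "square_integrable N = {f \<in> borel_measurable N. integrable N (\<lambda>t. (f t)\<^sup>2)}"

lemma square_integrable_measurable [measurable_dest]:
  "f \<in> square_integrable N \<Longrightarrow> f \<in> borel_measurable N"
  by (simp add: square_integrable_def)

lemma square_integrable_0: "(\<lambda>_. 0) \<in> square_integrable N"
  by (simp add: square_integrable_def)

lemma square_integrable_iff_nn_integral:
  "f \<in> square_integrable N \<longleftrightarrow>
     f \<in> borel_measurable N \<and> (\<integral>\<^sup>+t. ennreal ((f t)\<^sup>2) \<partial>N) < \<infinity>"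
  by (auto simp: square_integrable_def integrable_iff_bounded)

lemma integrable_mult_square_integrable:
  assumes "f \<in> square_integrable N" "g \<in> square_integrable N"
  shows "integrable N (\<lambda>t. f t * g t)"
proof (rule Bochner_Integration.integrable_bound)
  show "integrable N (\<lambda>t. (f t)\<^sup>2 + (g t)\<^sup>2)"
    using assms by (auto simp: square_integrable_def)
  show "(\<lambda>t. f t * g t) \<in> borel_measurable N"
    using assms by (auto simp: square_integrable_def)
  have "\<bar>u * v\<bar> \<le> u\<^sup>2 + v\<^sup>2" for u v :: real
  proof -
    have "2 * (\<bar>u\<bar> * \<bar>v\<bar>) \<le> u\<^sup>2 + v\<^sup>2"
      using sum_squares_bound[of "\<bar>u\<bar>" "\<bar>v\<bar>"] by simp
    moreover have "0 \<le> \<bar>u\<bar> * \<bar>v\<bar>" by simp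
    ultimately show ?thesis unfolding abs_mult by linarith
  qed
  then show "AE t in N. norm (f t * g t) \<le> norm ((f t)\<^sup>2 + (g t)\<^sup>2)"
    by simp
qed

lemma square_integrable_add:
  assumes "f \<in> square_integrable N" "g \<in> square_integrable N"
  shows "(\<lambda>t. f t + g t) \<in> square_integrable N"
  using assms integrable_mult_square_integrable[OF assms]
  by (auto simp: square_integrable_def power2_sum mult.assoc)

lemma square_integrable_scale:
  "f \<in> square_integrable N \<Longrightarrow> (\<lambda>t. a * f t) \<in> square_integrable N"
  by (auto simp: square_integrable_def power_mult_distrib)

lemma square_integrable_diff:
  assumes "f \<in> square_integrable N" "g \<in> square_integrable N"
  shows "(\<lambda>t. f t - g t) \<in> square_integrable N"
  using square_integrable_add[OF assms(1) square_integrable_scale[OF assms(2), of "-1"]] by simp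

lemma nn_integral_square_eq:
  "f \<in> square_integrable N \<Longrightarrow>
     (\<integral>\<^sup>+t. ennreal ((f t)\<^sup>2) \<partial>N) = ennreal (\<integral>t. (f t)\<^sup>2 \<partial>N)"
  by (rule nn_integral_eq_integral) (auto simp: square_integrable_def)

text \<open>The weights \<open>2 ^ k\<close> avoid Minkowski's inequality for infinite sums: the squared increments
  have integrals of at most \<open>1 / 4 ^ k\<close>, hence stay summable almost everywhere after multiplication by \<open>2 ^ k\<close>, and
  \<open>u \<le> 2 ^ k * u\<^sup>2 + 1 / 2 ^ k\<close> then makes the increments themselves summable.\<close>

lemma fast_Cauchy_AE_convergent:
  fixes g :: "nat \<Rightarrow> 'a \<Rightarrow> real"
  assumes [measurable]: "\<And>k. g k \<in> borel_measurable N"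
    and fast: "\<And>k. (\<integral>\<^sup>+t. ennreal ((g (Suc k) t - g k t)\<^sup>2) \<partial>N) \<le> ennreal ((1/4) ^ k)"
  shows "AE t in N. convergent (\<lambda>k. g k t)"
proof -
  let ?d = "\<lambda>k t. 2 ^ k * (g (Suc k) t - g k t)\<^sup>2"
  have level: "(\<integral>\<^sup>+t. ennreal (?d k t) \<partial>N) \<le> ennreal ((1/2) ^ k)" for k
  proof -
    have "(\<integral>\<^sup>+t. ennreal (?d k t) \<partial>N)
        = ennreal (2 ^ k) * (\<integral>\<^sup>+t. ennreal ((g (Suc k) t - g k t)\<^sup>2) \<partial>N)"
      by (subst nn_integral_cmult[symmetric]) (auto simp: ennreal_mult)
    also have "\<dots> \<le> ennreal (2 ^ k) * ennreal ((1/4) ^ k)"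
      by (intro mult_left_mono fast) auto
    also have "\<dots> = ennreal ((1/2) ^ k)"
      by (subst ennreal_mult[symmetric]) (auto simp flip: power_mult_distrib)
    finally show ?thesis .
  qed
  have "(\<integral>\<^sup>+t. (\<Sum>k. ennreal (?d k t)) \<partial>N) = (\<Sum>k. \<integral>\<^sup>+t. ennreal (?d k t) \<partial>N)"
    by (rule nn_integral_suminf) auto
  also have "\<dots> \<le> (\<Sum>k. ennreal ((1/2) ^ k))"
    by (intro suminf_le level) auto
  also have "\<dots> = ennreal (\<Sum>k. (1/2) ^ k)"
    by (intro suminf_ennreal2) (auto intro: summable_geometric)
  also have "\<dots> < \<infinity>" by simp
  finally have "AE t in N. (\<Sum>k. ennreal (?d k t)) \<noteq> \<infinity>"
    by (intro nn_integral_PInf_AE) auto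
  then show ?thesis
  proof (rule eventually_mono)
    fix t assume "(\<Sum>k. ennreal (?d k t)) \<noteq> \<infinity>"
    then have "summable (\<lambda>k. ?d k t)"
      by (intro summable_suminf_not_top) auto
    moreover have "summable (\<lambda>k. (1/2::real) ^ k)"
      by (auto intro: summable_geometric)
    ultimately have "summable (\<lambda>k. ?d k t + (1/2) ^ k)"
      by (rule summable_add)
    moreover have "norm (g (Suc k) t - g k t) \<le> ?d k t + (1/2) ^ k" for k
    proof -
      let ?u = "\<bar>g (Suc k) t - g k t\<bar>"
      have "u \<le> c * u\<^sup>2 + 1 / c" if "c > 0" "u \<ge> 0" for c u :: real
      proof -
        have "c * u \<le> (c * u)\<^sup>2 + 1"
        proof -
          have "0 \<le> c * u" using that by simp
          moreover have "2 * (c * u) \<le> (c * u)\<^sup>2 + 1"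
            using sum_squares_bound[of "c * u" 1] by simp
          ultimately show ?thesis by linarith
        qed
        also have "\<dots> = c * (c * u\<^sup>2 + 1 / c)"
          using that by (simp add: power2_eq_square algebra_simps)
        finally show ?thesis
          using that by (simp only: mult_le_cancel_left_pos)
      qed
      from this[of "2 ^ k" ?u] show ?thesis
        by (simp add: power_one_over)
    qed
    ultimately have "summable (\<lambda>k. g (Suc k) t - g k t)"
      by (rule summable_comparison_test'[where N = 0])
    then have "convergent (\<lambda>n. g n t - g 0 t)"
      by (simp only: summable_iff_convergent sum_lessThan_telescope[of "\<lambda>k. g k t"])
    then show "convergent (\<lambda>k. g k t)"
      by (simp only: convergent_diff_const_right_iff)
  qed
qed

text \<open>A subsequence converges almost everywhere, and Fatou's lemma, applied to the distances of a fixed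
  member of the sequence from those of the subsequence, turns this into convergence in the mean of
  the entire sequence.\<close>

lemma square_integrable_complete:
  assumes f: "\<And>n. f n \<in> square_integrable N"
    and Cauchy: "\<And>e. e > 0 \<Longrightarrow> \<exists>n0. \<forall>m\<ge>n0. \<forall>n\<ge>n0. (\<integral>t. (f m t - f n t)\<^sup>2 \<partial>N) < e"
  obtains l where "l \<in> square_integrable N" "(\<lambda>n. \<integral>t. (f n t - l t)\<^sup>2 \<partial>N) \<longlonglongrightarrow> 0"
proof -
  have [measurable]: "f n \<in> borel_measurable N" for n
    using f by (rule square_integrable_measurable)
  have "\<exists>n0. \<forall>k. \<forall>m\<ge>n0 k. \<forall>n\<ge>n0 k. (\<integral>t. (f m t - f n t)\<^sup>2 \<partial>N) < (1/4) ^ k"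
    by (intro choice allI Cauchy) simp
  then obtain n0 where n0: "\<And>k m n. \<lbrakk>m \<ge> n0 k; n \<ge> n0 k\<rbrakk> \<Longrightarrow> (\<integral>t. (f m t - f n t)\<^sup>2 \<partial>N) < (1/4) ^ k"
    by blast
  \<comment> \<open>The partial sums make the thresholds monotone, so that \<open>r (Suc k)\<close> is beyond \<open>n0 k\<close> as well;
    the summand \<open>k\<close> makes \<open>r\<close> tend to infinity.\<close>
  define r where "r k = k + (\<Sum>j\<le>k. n0 j)" for k
  have r: "n0 k \<le> r k" "n0 k \<le> r (Suc k)" "k \<le> r k" for k
    using member_le_sum[of k "{..k}" n0] by (auto simp: r_def)
  have nn: "(\<integral>\<^sup>+t. ennreal ((f m t - f n t)\<^sup>2) \<partial>N) = ennreal (\<integral>t. (f m t - f n t)\<^sup>2 \<partial>N)" for m n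
    by (rule nn_integral_square_eq[OF square_integrable_diff[OF f f]])
  have conv: "AE t in N. convergent (\<lambda>k. f (r k) t)"
    by (rule fast_Cauchy_AE_convergent) (simp_all add: nn ennreal_leI less_imp_le[OF n0[OF r(2,1)]])
  define l where "l t = lim (\<lambda>k. f (r k) t)" for t
  have [measurable]: "l \<in> borel_measurable N"
    unfolding l_def by measurable
  have bound: "(\<integral>\<^sup>+t. ennreal ((f m t - l t)\<^sup>2) \<partial>N) \<le> ennreal e"
    if "e > 0" and n1: "\<And>m n. \<lbrakk>m \<ge> n1; n \<ge> n1\<rbrakk> \<Longrightarrow> (\<integral>t. (f m t - f n t)\<^sup>2 \<partial>N) < e" and "m \<ge> n1" for e m n1
  proof -
    have "(\<integral>\<^sup>+t. ennreal ((f m t - l t)\<^sup>2) \<partial>N)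
        = (\<integral>\<^sup>+t. liminf (\<lambda>k. ennreal ((f m t - f (r k) t)\<^sup>2)) \<partial>N)"
    proof (rule nn_integral_cong_AE, use conv in eventually_elim)
      case (elim t)
      then have "(\<lambda>k. f (r k) t) \<longlonglongrightarrow> l t"
        by (simp add: l_def convergent_LIMSEQ_iff)
      then have "(\<lambda>k. ennreal ((f m t - f (r k) t)\<^sup>2)) \<longlonglongrightarrow> ennreal ((f m t - l t)\<^sup>2)"
        by (intro tendsto_intros)
      then show ?case
        by (rule lim_imp_Liminf[symmetric, rotated]) simp
    qed
    also have "\<dots> \<le> liminf (\<lambda>k. \<integral>\<^sup>+t. ennreal ((f m t - f (r k) t)\<^sup>2) \<partial>N)"
      by (rule nn_integral_liminf) simp
    also have "\<dots> \<le> limsup (\<lambda>k. \<integral>\<^sup>+t. ennreal ((f m t - f (r k) t)\<^sup>2) \<partial>N)"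
      by (rule Liminf_le_Limsup) simp
    also have "\<dots> \<le> ennreal e"
    proof (rule Limsup_bounded)
      show "\<forall>\<^sub>F k in sequentially. (\<integral>\<^sup>+t. ennreal ((f m t - f (r k) t)\<^sup>2) \<partial>N) \<le> ennreal e"
        using eventually_ge_at_top[of n1]
      proof eventually_elim
        case (elim k)
        then show ?case
          using n1[OF \<open>m \<ge> n1\<close>, of "r k"] r(3)[of k] by (auto simp: nn intro!: ennreal_leI)
      qed
    qed
    finally show ?thesis .
  qed
  have diff: "(\<lambda>t. f (n0 0) t - l t) \<in> square_integrable N"
    using bound[OF zero_less_one, of "n0 0" "n0 0"] n0[of 0]
    by (simp add: square_integrable_iff_nn_integral le_less_trans[OF _ ennreal_one_less_top])
  have l: "l \<in> square_integrable N"
    using square_integrable_diff[OF f[of "n0 0"] diff] by simp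
  have "(\<lambda>n. \<integral>t. (f n t - l t)\<^sup>2 \<partial>N) \<longlonglongrightarrow> 0"
  proof (rule LIMSEQ_I)
    fix e :: real assume "e > 0"
    then have "e/2 > 0" by simp
    from Cauchy[OF this] obtain n1
      where n1: "\<And>m n. \<lbrakk>m \<ge> n1; n \<ge> n1\<rbrakk> \<Longrightarrow> (\<integral>t. (f m t - f n t)\<^sup>2 \<partial>N) < e/2" by blast
    have "(\<integral>t. (f n t - l t)\<^sup>2 \<partial>N) \<le> e/2" if "n \<ge> n1" for n
      using bound[OF \<open>e/2 > 0\<close> n1 that] \<open>e > 0\<close>
      by (simp add: nn_integral_square_eq[OF square_integrable_diff[OF f l]] ennreal_le_iff)
    then show "\<exists>no. \<forall>n\<ge>no. norm ((\<integral>t. (f n t - l t)\<^sup>2 \<partial>N) - 0) < e"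
      using \<open>e > 0\<close> by (intro exI[of _ n1] allI impI) (simp add: le_less_trans[of _ "e/2" e])
  qed
  with l show thesis by (rule that)
qed

text \<open>Points of the Hilbert space are canonical representatives of the classes modulo equality almost
  everywhere. They are functions, so that the operations need no lifting to sets of functions, and
  equality of points is equality almost everywhere by \<open>AE_L2_rep\<close> and \<open>L2_rep_cong\<close>.\<close>

definition L2_rep :: "'a measure \<Rightarrow> ('a \<Rightarrow> real) \<Rightarrow> ('a \<Rightarrow> real)" where
  "L2_rep N f = (SOME g. g \<in> square_integrable N \<and> (AE t in N. f t = g t))"

lemma L2_rep:
  assumes "f \<in> square_integrable N"
  shows L2_rep_square_integrable: "L2_rep N f \<in> square_integrable N"
    and AE_L2_rep: "AE t in N. f t = L2_rep N f t"
proof -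
  have "f \<in> square_integrable N \<and> (AE t in N. f t = f t)"
    using assms by simp
  then have "L2_rep N f \<in> square_integrable N \<and> (AE t in N. f t = L2_rep N f t)"
    unfolding L2_rep_def
    by (rule someI[where P = "\<lambda>g. g \<in> square_integrable N \<and> (AE t in N. f t = g t)"])
  then show "L2_rep N f \<in> square_integrable N" "AE t in N. f t = L2_rep N f t"
    by auto
qed

lemma L2_rep_cong:
  assumes "AE t in N. f t = g t"
  shows "L2_rep N f = L2_rep N g"
proof -
  have "(AE t in N. f t = h t) \<longleftrightarrow> (AE t in N. g t = h t)" for h
    using assms by (auto elim: eventually_elim2)
  then show ?thesis by (simp add: L2_rep_def)
qed

definition L2_space :: "'a measure \<Rightarrow> ('a \<Rightarrow> real) inner_product_structure" where
  "L2_space N = \<lparr>carrier = L2_rep N ` square_integrable N,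
     monoid.mult = undefined, one = undefined, zero = L2_rep N (\<lambda>_. 0),
     add = (\<lambda>f g. L2_rep N (\<lambda>t. f t + g t)), smult = (\<lambda>a f. L2_rep N (\<lambda>t. a * f t)),
     ip = (\<lambda>f g. \<integral>t. f t * g t \<partial>N)\<rparr>"

lemma carrier_L2_space: "carrier (L2_space N) = L2_rep N ` square_integrable N"
  and zero_L2_space: "\<zero>\<^bsub>L2_space N\<^esub> = L2_rep N (\<lambda>_. 0)"
  by (simp_all add: L2_space_def)

lemma add_L2_space:
  assumes "f \<in> square_integrable N" "g \<in> square_integrable N"
  shows "L2_rep N f \<oplus>\<^bsub>L2_space N\<^esub> L2_rep N g = L2_rep N (\<lambda>t. f t + g t)"
proof -
  have "AE t in N. L2_rep N f t + L2_rep N g t = f t + g t"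
    using AE_L2_rep[OF assms(1)] AE_L2_rep[OF assms(2)] by eventually_elim simp
  from L2_rep_cong[OF this] show ?thesis
    by (simp add: L2_space_def)
qed

lemma smult_L2_space:
  assumes "f \<in> square_integrable N"
  shows "a \<odot>\<^bsub>L2_space N\<^esub> L2_rep N f = L2_rep N (\<lambda>t. a * f t)"
proof -
  have "AE t in N. a * L2_rep N f t = a * f t"
    using AE_L2_rep[OF assms(1)] by eventually_elim simp
  from L2_rep_cong[OF this] show ?thesis
    by (simp add: L2_space_def)
qed

lemma ip_L2_space:
  assumes "f \<in> square_integrable N" "g \<in> square_integrable N"
  shows "ip (L2_space N) (L2_rep N f) (L2_rep N g) = (\<integral>t. f t * g t \<partial>N)"
proof -
  have [measurable]: "f \<in> borel_measurable N" "g \<in> borel_measurable N"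
      "L2_rep N f \<in> borel_measurable N" "L2_rep N g \<in> borel_measurable N"
    using assms L2_rep_square_integrable by (auto intro: square_integrable_measurable)
  have "AE t in N. L2_rep N f t * L2_rep N g t = f t * g t"
    using AE_L2_rep[OF assms(1)] AE_L2_rep[OF assms(2)] by eventually_elim simp
  then show ?thesis
    by (auto simp: L2_space_def intro!: integral_cong_AE)
qed

text \<open>With these rules every vector space law of \<open>L2_space N\<close> becomes the corresponding law for functions
  below a single \<open>L2_rep N\<close>.\<close>

lemmas L2_space_simps =
  carrier_L2_space zero_L2_space add_L2_space smult_L2_space ip_L2_space
  square_integrable_0 square_integrable_add square_integrable_scale

theorem real_Hilbert_space_L2_space: "real_Hilbert_space (L2_space N)"
proof (rule real_Hilbert_spaceI, goal_cases)
  case (7 x)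
  then obtain f where f: "f \<in> square_integrable N" "x = L2_rep N f"
    by (auto simp: carrier_L2_space)
  from add_L2_space[OF square_integrable_scale[OF f(1), of "-1"] f(1)] show ?case
    by (simp add: f smult_L2_space zero_L2_space)
next
  case (13 x y z)
  then show ?case
    by (auto simp: L2_space_simps integrable_mult_square_integrable distrib_right)
next
  case (16 x)
  then obtain f where f: "f \<in> square_integrable N" "x = L2_rep N f"
    by (auto simp: L2_space_simps)
  then have "(\<integral>t. (f t)\<^sup>2 \<partial>N) = 0" and i: "integrable N (\<lambda>t. (f t)\<^sup>2)"
    using 16 by (auto simp: L2_space_simps power2_eq_square square_integrable_def)
  then have "AE t in N. f t = 0"
    by (subst (asm) integral_nonneg_eq_0_iff_AE) auto
  from L2_rep_cong[OF this] show ?case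
    using f by (simp add: zero_L2_space)
next
  case (17 \<sigma>)
  have "\<forall>n. \<exists>g. g \<in> square_integrable N \<and> \<sigma> n = L2_rep N g"
    using 17(1) unfolding carrier_L2_space by blast
  from choice[OF this] obtain \<tau> where \<tau>: "\<And>n. \<tau> n \<in> square_integrable N" "\<And>n. \<sigma> n = L2_rep N (\<tau> n)"
    by blast
  have dist: "ip (L2_space N)
      (L2_rep N f \<oplus>\<^bsub>L2_space N\<^esub> (-1) \<odot>\<^bsub>L2_space N\<^esub> L2_rep N g)
      (L2_rep N f \<oplus>\<^bsub>L2_space N\<^esub> (-1) \<odot>\<^bsub>L2_space N\<^esub> L2_rep N g) = (\<integral>t. (f t - g t)\<^sup>2 \<partial>N)"
    if "f \<in> square_integrable N" "g \<in> square_integrable N" for f g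
    using that square_integrable_diff[OF that]
      square_integrable_scale[OF that(2), of "-1"]
    by (simp add: smult_L2_space add_L2_space ip_L2_space power2_eq_square)
  obtain l where l: "l \<in> square_integrable N" "(\<lambda>n. \<integral>t. (\<tau> n t - l t)\<^sup>2 \<partial>N) \<longlonglongrightarrow> 0"
  proof (rule square_integrable_complete[OF \<tau>(1)])
    fix e :: real assume "e > 0"
    then have "sqrt e > 0" by simp
    from 17(2)[OF this] show "\<exists>n0. \<forall>m\<ge>n0. \<forall>n\<ge>n0. (\<integral>t. (\<tau> m t - \<tau> n t)\<^sup>2 \<partial>N) < e"
      by (simp add: \<tau> dist)
  qed
  show ?case
  proof
    show "L2_rep N l \<in> carrier (L2_space N)"
      using l by (simp add: L2_space_simps)
    show "(\<lambda>n. sqrt (ip (L2_space N)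
        (\<sigma> n \<oplus>\<^bsub>L2_space N\<^esub> (-1) \<odot>\<^bsub>L2_space N\<^esub> L2_rep N l)
        (\<sigma> n \<oplus>\<^bsub>L2_space N\<^esub> (-1) \<odot>\<^bsub>L2_space N\<^esub> L2_rep N l))) \<longlonglongrightarrow> 0"
      using tendsto_real_sqrt[OF l(2)] by (simp add: \<tau> dist l)
  qed
qed (auto simp: L2_space_simps algebra_simps)

lemma ip_dist_L2_space:
  assumes "f \<in> square_integrable N" "g \<in> square_integrable N"
  shows "ip_dist (L2_space N) (L2_rep N f) (L2_rep N g) = sqrt (\<integral>t. (f t - g t)\<^sup>2 \<partial>N)"
proof -
  interpret real_Hilbert_space "L2_space N" by (rule real_Hilbert_space_L2_space)
  show ?thesis
    using assms square_integrable_diff[OF assms] square_integrable_scale[OF assms(2), of "-1"]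
    by (simp add: ip_dist_eq L2_space_simps power2_eq_square)
qed

section \<open>Powers of the distance on the line as squared Hilbert space distances\<close>

text \<open>Subtracting \<open>1\<close> normalizes \<open>wave p 0\<close> to \<open>0\<close>. Without it the function would not be square
  integrable near \<open>s = 0\<close>, although differences of two such functions are.\<close>

definition wave :: "real \<Rightarrow> real \<Rightarrow> real \<Rightarrow> real" where
  "wave p a s = (cos (s * a) + sin (s * a) - 1) * \<bar>s\<bar> powr (- (1 + p) / 2)"

definition wave_const :: "real \<Rightarrow> ennreal" where
  "wave_const p = (\<integral>\<^sup>+s. ennreal ((2 - 2 * cos s) * \<bar>s\<bar> powr (- (1 + p))) \<partial>lborel)"

lemma wave_0 [simp]: "wave p 0 s = 0"
  by (simp add: wave_def)

lemma measurable_wave [measurable]: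
  assumes [measurable]: "f \<in> borel_measurable N" "g \<in> borel_measurable N"
  shows "(\<lambda>t. wave p (f t) (g t)) \<in> borel_measurable N"
  unfolding wave_def by measurable

text \<open>Homogeneity: the measure with density \<open>\<bar>s\<bar> powr (- (1 + p))\<close> is multiplied by \<open>\<bar>a\<bar> powr p\<close> under
  the substitution \<open>s \<mapsto> a * s\<close>.\<close>

lemma nn_integral_cos_scale:
  "(\<integral>\<^sup>+s. ennreal ((2 - 2 * cos (s * a)) * \<bar>s\<bar> powr (- (1 + p))) \<partial>lborel)
     = wave_const p * ennreal (\<bar>a\<bar> powr p)"
proof (cases "a = 0")
  case False
  let ?G = "\<lambda>s::real. (2 - 2 * cos s) * \<bar>s\<bar> powr (- (1 + p))"
  have "wave_const p * ennreal (\<bar>a\<bar> powr p)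
      = ennreal \<bar>a\<bar> * (\<integral>\<^sup>+s. ennreal (?G (0 + a * s)) \<partial>lborel) * ennreal (\<bar>a\<bar> powr p)"
    unfolding wave_const_def using False by (subst nn_integral_real_affine[where t = 0 and c = a]) auto
  also have "\<dots> = ennreal (\<bar>a\<bar> * \<bar>a\<bar> powr p) * (\<integral>\<^sup>+s. ennreal (?G (0 + a * s)) \<partial>lborel)"
    by (simp add: ennreal_mult mult_ac)
  also have "\<dots> = (\<integral>\<^sup>+s. ennreal (\<bar>a\<bar> * \<bar>a\<bar> powr p) * ennreal (?G (0 + a * s)) \<partial>lborel)"
    by (rule nn_integral_cmult[symmetric]) auto
  also have "\<dots> = (\<integral>\<^sup>+s. ennreal ((2 - 2 * cos (s * a)) * \<bar>s\<bar> powr (- (1 + p))) \<partial>lborel)"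
  proof (rule nn_integral_cong)
    fix s :: real
    have "\<bar>a\<bar> * \<bar>a\<bar> powr p * \<bar>a * s\<bar> powr (- (1 + p)) =
        \<bar>a\<bar> powr 1 * \<bar>a\<bar> powr p * \<bar>a\<bar> powr (- (1 + p)) * \<bar>s\<bar> powr (- (1 + p))"
      using False by (simp add: abs_mult powr_mult)
    also have "\<bar>a\<bar> powr 1 * \<bar>a\<bar> powr p * \<bar>a\<bar> powr (- (1 + p)) = 1"
      using False unfolding powr_add[symmetric] by simp
    finally have "\<bar>a\<bar> * \<bar>a\<bar> powr p * \<bar>a * s\<bar> powr (- (1 + p)) = \<bar>s\<bar> powr (- (1 + p))"
      by simp
    then have "\<bar>a\<bar> * \<bar>a\<bar> powr p * ?G (0 + a * s) = (2 - 2 * cos (s * a)) * \<bar>s\<bar> powr (- (1 + p))"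
      by (simp add: mult_ac)
    then show "ennreal (\<bar>a\<bar> * \<bar>a\<bar> powr p) * ennreal (?G (0 + a * s))
        = ennreal ((2 - 2 * cos (s * a)) * \<bar>s\<bar> powr (- (1 + p)))"
      by (metis abs_ge_zero ennreal_mult' mult_nonneg_nonneg powr_ge_zero)
  qed
  finally show ?thesis by simp
qed simp

text \<open>The square of \<open>wave p a s - wave p b s\<close> contains the product of a difference of cosines with a
  difference of sines. This is odd in \<open>s\<close>, so adding the values at \<open>s\<close> and \<open>- s\<close> removes it; both
  values have the same integral.\<close>

lemma nn_integral_wave_diff:
  "(\<integral>\<^sup>+s. ennreal ((wave p a s - wave p b s)\<^sup>2) \<partial>lborel) = wave_const p * ennreal (\<bar>a - b\<bar> powr p)"
proof -
  let ?h = "\<lambda>s. (wave p a s - wave p b s)\<^sup>2"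
  let ?G = "\<lambda>s. (2 - 2 * cos (s * (a - b))) * \<bar>s\<bar> powr (- (1 + p))"
  have reflect: "(\<integral>\<^sup>+s. ennreal (?h s) \<partial>lborel) = (\<integral>\<^sup>+s. ennreal (?h (- s)) \<partial>lborel)"
    by (subst nn_integral_real_affine[where t = 0 and c = "-1"]) auto
  have sym: "?h s + ?h (- s) = 2 * ?G s" for s
  proof -
    let ?w = "\<bar>s\<bar> powr (- (1 + p) / 2)"
    have w: "?w\<^sup>2 = \<bar>s\<bar> powr (- (1 + p))"
      by (simp add: power2_eq_square flip: powr_add)
    have "?h s = ((cos (s * a) - cos (s * b) + (sin (s * a) - sin (s * b))) * ?w)\<^sup>2"
      by (simp add: wave_def algebra_simps)
    moreover have "?h (- s) = ((cos (s * a) - cos (s * b) - (sin (s * a) - sin (s * b))) * ?w)\<^sup>2"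
      by (simp add: wave_def algebra_simps)
    ultimately have "?h s + ?h (- s)
        = 2 * ((cos (s * a) - cos (s * b))\<^sup>2 + (sin (s * a) - sin (s * b))\<^sup>2) * ?w\<^sup>2"
      by (simp only: power_mult_distrib power2_sum power2_diff) (simp only: algebra_simps)
    also have "(cos (s * a) - cos (s * b))\<^sup>2 + (sin (s * a) - sin (s * b))\<^sup>2
        = ((sin (s * a))\<^sup>2 + (cos (s * a))\<^sup>2) + ((sin (s * b))\<^sup>2 + (cos (s * b))\<^sup>2)
          - 2 * (cos (s * a) * cos (s * b) + sin (s * a) * sin (s * b))"
      by (simp add: power2_eq_square algebra_simps)
    also have "\<dots> = 2 - 2 * cos (s * (a - b))"
      by (simp add: cos_diff right_diff_distrib)
    finally show ?thesis by (simp only: w mult.assoc)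
  qed
  have "2 * (\<integral>\<^sup>+s. ennreal (?h s) \<partial>lborel) = (\<integral>\<^sup>+s. ennreal (?h s) + ennreal (?h (- s)) \<partial>lborel)"
    by (subst nn_integral_add) (auto simp flip: reflect mult_2)
  also have "\<dots> = (\<integral>\<^sup>+s. 2 * ennreal (?G s) \<partial>lborel)"
    by (intro nn_integral_cong) (simp add: sym ennreal_mult' flip: ennreal_plus)
  also have "\<dots> = 2 * (\<integral>\<^sup>+s. ennreal (?G s) \<partial>lborel)"
    by (rule nn_integral_cmult) auto
  finally show ?thesis
    unfolding nn_integral_cos_scale by (simp add: ennreal_mult_cancel_left)
qed

lemma wave_const_pos: "0 < wave_const p"
proof (rule ccontr)
  assume "\<not> 0 < wave_const p"
  then have "AE s in lborel. ennreal ((2 - 2 * cos s) * \<bar>s\<bar> powr (- (1 + p))) = 0"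
    unfolding wave_const_def by (subst nn_integral_0_iff_AE[symmetric]) auto
  then have "AE s in lborel. s \<notin> {0<..<1::real}"
  proof eventually_elim
    case (elim s)
    have "cos s < 1" if "0 < s" "s < 1"
      using that pi_gt3 by (subst cos_zero[symmetric], subst cos_mono_less_eq) auto
    with elim show ?case
      by (auto simp: ennreal_eq_0_iff mult_le_0_iff)
  qed
  then have "emeasure lborel {0<..<1::real} = 0"
    by (subst (asm) AE_iff_measurable[where N = "{0<..<1}"]) auto
  then show False by (simp only: emeasure_lborel_Ioo) simp
qed

text \<open>Near \<open>0\<close> the integrand is at most \<open>\<bar>s\<bar> powr (1 - p)\<close>, which is integrable because \<open>p < 2\<close>; far
  from \<open>0\<close> it is at most \<open>4 * \<bar>s\<bar> powr (- (1 + p))\<close>, which is integrable because \<open>p > 0\<close>.\<close>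

lemma wave_const_finite:
  assumes "0 < p" "p < 2"
  shows "wave_const p < \<infinity>"
proof -
  let ?G = "\<lambda>s::real. (2 - 2 * cos s) * \<bar>s\<bar> powr (- (1 + p))"
  \<comment> \<open>The bound for positive \<open>s\<close>; for negative \<open>s\<close> it is reflected.\<close>
  let ?g = "\<lambda>s::real. indicator {0..1} s * s powr (1 - p) + 4 * (indicator {1..} s * s powr (- (1 + p)))"
  have g: "(\<integral>\<^sup>+s. ennreal (?g s) \<partial>lborel) < \<infinity>"
  proof -
    have "(\<integral>\<^sup>+s. ennreal (?g s) \<partial>lborel)
        = (\<integral>\<^sup>+s. ennreal (indicator {0..1} s * s powr (1 - p)) \<partial>lborel)
          + 4 * (\<integral>\<^sup>+s. ennreal (indicator {1..} s * s powr (- (1 + p))) \<partial>lborel)"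
      by (simp add: ennreal_plus ennreal_mult nn_integral_add nn_integral_cmult)
    also have "\<dots> = ennreal (1 powr (1 - p + 1) / (1 - p + 1))
          + 4 * ennreal (- (1 powr (- (1 + p) + 1)) / (- (1 + p) + 1))"
      using nn_integral_has_integral_lebesgue[OF _ has_integral_powr_from_0[of "1 - p" 1]]
        nn_integral_has_integral_lebesgue[OF _ has_integral_powr_to_inf[of "- (1 + p)" 1]] assms
      by simp
    also have "\<dots> < \<infinity>" by (simp add: ennreal_mult_less_top)
    finally show ?thesis .
  qed
  have le: "?G s \<le> ?g s + ?g (- s)" for s
  proof -
    have *: "?G s \<le> ?g s" if "s > 0" for s
    proof (cases "s < 1")
      case True
      have "2 - 2 * cos s = 4 * (sin (s / 2))\<^sup>2"
        using cos_double_sin[of "s / 2"] by simp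
      also have "\<dots> \<le> 4 * (s / 2)\<^sup>2"
        using abs_sin_x_le_abs_x[of "s / 2"] by (simp only: abs_le_square_iff)
      finally have "2 - 2 * cos s \<le> s powr 2"
        using that by (simp add: power_divide)
      then have "?G s \<le> s powr 2 * s powr (- (1 + p))"
        using that by (intro mult_mono) auto
      also have "\<dots> = s powr (1 - p)"
        by (simp flip: powr_add)
      finally show ?thesis using that True by simp
    next
      case False
      have "2 - 2 * cos s \<le> 4"
        using cos_ge_minus_one[of s] by linarith
      then have "?G s \<le> 4 * s powr (- (1 + p))"
        using that by (intro mult_mono) auto
      then show ?thesis using False by (auto simp: indicator_def)
    qed
    have nonneg: "0 \<le> ?g s" for s by simp
    consider "s > 0" | "s = 0" | "- s > 0" by linarith
    then show ?thesis
      by cases (use *[of s] *[of "- s"] nonneg[of s] nonneg[of "- s"] in auto)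
  qed
  have "wave_const p \<le> (\<integral>\<^sup>+s. ennreal (?g s) + ennreal (?g (- s)) \<partial>lborel)"
    unfolding wave_const_def
    by (intro nn_integral_mono) (use le in \<open>simp flip: ennreal_plus add: ennreal_leI\<close>)
  also have "\<dots> = (\<integral>\<^sup>+s. ennreal (?g s) \<partial>lborel) + (\<integral>\<^sup>+s. ennreal (?g (- s)) \<partial>lborel)"
    by (rule nn_integral_add) auto
  also have "(\<integral>\<^sup>+s. ennreal (?g (- s)) \<partial>lborel) = (\<integral>\<^sup>+s. ennreal (?g s) \<partial>lborel)"
    by (subst (2) nn_integral_real_affine[where t = 0 and c = "-1"]) auto
  also have "(\<integral>\<^sup>+s. ennreal (?g s) \<partial>lborel) + (\<integral>\<^sup>+s. ennreal (?g s) \<partial>lborel) < \<infinity>"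
    using g by (simp only: infinity_ennreal_def ennreal_add_less_top)
  finally show ?thesis .
qed

section \<open>The embedding of \<open>L\<^sub>p(\<mu>)\<close>\<close>

lemma nn_integral_wave_pair:
  assumes [measurable]: "x \<in> borel_measurable M" "y \<in> borel_measurable M"
  shows "(\<integral>\<^sup>+z. ennreal ((wave p (x (fst z)) (snd z) - wave p (y (fst z)) (snd z))\<^sup>2) \<partial>(M \<Otimes>\<^sub>M lborel))
    = wave_const p * (\<integral>\<^sup>+t. ennreal (\<bar>x t - y t\<bar> powr p) \<partial>M)"
proof -
  have "(\<integral>\<^sup>+z. ennreal ((wave p (x (fst z)) (snd z) - wave p (y (fst z)) (snd z))\<^sup>2) \<partial>(M \<Otimes>\<^sub>M lborel))
      = (\<integral>\<^sup>+t. \<integral>\<^sup>+s. ennreal ((wave p (x t) s - wave p (y t) s)\<^sup>2) \<partial>lborel \<partial>M)"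
    by (subst lborel.nn_integral_fst[symmetric]) auto
  also have "\<dots> = wave_const p * (\<integral>\<^sup>+t. ennreal (\<bar>x t - y t\<bar> powr p) \<partial>M)"
    by (simp add: nn_integral_wave_diff nn_integral_cmult)
  finally show ?thesis .
qed

lemma wave_square_integrable:
  assumes p: "0 < p" "p < 2" and x: "x \<in> Lp_functions p M"
  shows "(\<lambda>z. wave p (x (fst z)) (snd z)) \<in> square_integrable (M \<Otimes>\<^sub>M lborel)"
proof -
  have [measurable]: "x \<in> borel_measurable M" and i: "integrable M (\<lambda>t. \<bar>x t\<bar> powr p)"
    using x by (auto simp: Lp_functions_def)
  have "(\<integral>\<^sup>+z. ennreal ((wave p (x (fst z)) (snd z))\<^sup>2) \<partial>(M \<Otimes>\<^sub>M lborel))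
      = wave_const p * (\<integral>\<^sup>+t. ennreal (\<bar>x t\<bar> powr p) \<partial>M)"
    using nn_integral_wave_pair[of x M "\<lambda>_. 0" p] by simp
  also have "\<dots> < \<infinity>"
    using wave_const_finite[OF p] i by (simp add: ennreal_mult_less_top integrable_iff_bounded)
  finally show ?thesis
    by (simp add: square_integrable_iff_nn_integral)
qed

lemma integral_wave_pair:
  assumes "x \<in> Lp_functions p M" "y \<in> Lp_functions p M"
  shows "(\<integral>z. (wave p (x (fst z)) (snd z) - wave p (y (fst z)) (snd z))\<^sup>2 \<partial>(M \<Otimes>\<^sub>M lborel))
    = enn2real (wave_const p) * (\<integral>t. \<bar>x t - y t\<bar> powr p \<partial>M)"
proof -
  have [measurable]: "x \<in> borel_measurable M" "y \<in> borel_measurable M"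
    using assms by (auto simp: Lp_functions_def)
  show ?thesis
    by (simp add: integral_eq_nn_integral nn_integral_wave_pair enn2real_mult)
qed

theorem coarsely_embeds_into_Hilbert_Lp_space:
  assumes p: "0 < p" "p < 2"
  shows "coarsely_embeds_into_Hilbert (Lp_space p M) (Lp_dist p M)"
proof (rule coarsely_embeds_into_HilbertI)
  let ?H = "L2_space (M \<Otimes>\<^sub>M lborel)"
  define rep :: "('a \<Rightarrow> real) set \<Rightarrow> 'a \<Rightarrow> real" where "rep A = (SOME x. x \<in> A)" for A
  define W where "W A z = wave p (rep A (fst z)) (snd z)" for A and z :: "'a \<times> real"
  define C where "C = enn2real (wave_const p)"
  define \<rho> where "\<rho> d = sqrt C * d powr (p / 2)" for d
  show "real_Hilbert_space ?H"
    by (rule real_Hilbert_space_L2_space)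
  have C: "C > 0"
    using wave_const_pos[of p] wave_const_finite[OF p] by (simp add: C_def enn2real_positive_iff)
  have rep: "rep A \<in> Lp_functions p M" if "A \<in> Lp_space p M" for A
  proof -
    have "A \<noteq> {}" "A \<subseteq> Lp_functions p M"
      using that in_quotient_imp_non_empty[OF equiv_ae_equal, of A p M]
        in_quotient_imp_subset[OF equiv_ae_equal, of A p M] by (auto simp: Lp_space_def)
    then show ?thesis
      unfolding rep_def by (metis ex_in_conv someI_ex subsetD)
  qed
  have W: "W A \<in> square_integrable (M \<Otimes>\<^sub>M lborel)" if "A \<in> Lp_space p M" for A
    using wave_square_integrable[OF p rep[OF that]] by (simp add: W_def[abs_def])
  have dist: "ip_dist ?H (L2_rep (M \<Otimes>\<^sub>M lborel) (W A)) (L2_rep (M \<Otimes>\<^sub>M lborel) (W B))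
      = \<rho> (Lp_dist p M A B)" if AB: "A \<in> Lp_space p M" "B \<in> Lp_space p M" for A B
  proof -
    let ?I = "\<integral>t. \<bar>rep A t - rep B t\<bar> powr p \<partial>M"
    have "ip_dist ?H (L2_rep (M \<Otimes>\<^sub>M lborel) (W A)) (L2_rep (M \<Otimes>\<^sub>M lborel) (W B)) = sqrt (C * ?I)"
      using ip_dist_L2_space[OF W W, OF AB] integral_wave_pair[OF rep rep, OF AB]
      by (simp add: W_def C_def)
    also have "\<dots> = sqrt C * sqrt ?I"
      by (rule real_sqrt_mult)
    also have "sqrt ?I = (?I powr (1 / p)) powr (p / 2)"
      using p by (simp add: powr_powr powr_half_sqrt)
    finally show ?thesis
      by (simp add: \<rho>_def Lp_dist_def rep_def)
  qed
  have "filterlim \<rho> at_top at_top"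
    unfolding \<rho>_def using C p
    by (intro filterlim_tendsto_pos_mult_at_top[OF tendsto_const] real_powr_at_top) auto
  moreover have "mono_on {0..} \<rho>"
    unfolding \<rho>_def using C p by (intro mono_onI mult_left_mono powr_mono2) auto
  moreover have "\<rho> \<in> {0..} \<rightarrow> {0..}"
    using C by (simp add: \<rho>_def)
  ultimately show "coarse_embedding (Lp_space p M) (Lp_dist p M) (carrier ?H) (ip_dist ?H)
      (\<lambda>A. L2_rep (M \<Otimes>\<^sub>M lborel) (W A))"
    unfolding coarse_embedding_def
    by (intro conjI exI[of _ \<rho>]) (auto simp: dist carrier_L2_space W)
qed

theorem proposition4p1:
  fixes M :: "'a measure" and p :: real
  assumes "0 < p" and "p < 2"
  shows "coarsely_embeds_into_Hilbert (Lp_space p M) (Lp_dist p M) \<and>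
    coarsely_embeds_into_Hilbert
      (Lp_space p (count_space (UNIV :: nat set))) (Lp_dist p (count_space (UNIV :: nat set)))"
  using assms by (simp add: coarsely_embeds_into_Hilbert_Lp_space)

end
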